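(* Let $(T_t)_{t\geq0}$ be a bounded $C_0$-semigroup on a $K$-convex Banach space. If there exists $\delta>0$ such that $\{e^{-\delta t}T_t: t\geq0\}$ is $\gamma$-bounded, then $\{e^{-\delta t}T_t: t\geq0\}$ is $\gamma$-bounded for every $\delta>0$.
   Context: All Banach spaces are complex. $(\gamma_n)_{n\geq1}$ is a sequence of independent complex standard Gaussian variables on a probability space $\Sigma$; $G(X)$ is the closure of $\{\sum_{k=1}^n\gamma_k\otimes x_k: x_k\in X,\ n\in\mathbb{N}\}$ in $L^2(\Sigma,X)$, with the induced norm. A set $\mathcal{T}\subset\mathcal{L}(X)$ is $\gamma$-bounded if there is $C\geq0$ such that $\|\sum_{n=1}^N\gamma_n\otimes T_nx_n\|_{G(X)}\leq C\|\sum_{n=1}^N\gamma_n\otimes x_n\|_{G(X)}$ for all finite sequences $(T_n)\subset\mathcal{T}$, $(x_n)\subset X$. $X$ is $K$-convex iff (equivalently to having non-trivial type) there is $K>0$ such that for all $x_1,\ldots,x_N\in X$, $\|\sum_n\gamma_n\otimes x_n\|_{G(X)}\leq K\sup\{|\sum_n\langle x_n,y_n\rangle|: y_n\in X^*,\ \|\sum_n\gamma_n\otimes y_n\|_{G(X^* )}\leq1\}$. *)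

theory Defs
  imports "HOL-Probability.Probability"
begin

section \<open>Complex Banach spaces\<close>

class scaleC = scaleR +
  fixes scaleC :: "complex \<Rightarrow> 'a \<Rightarrow> 'a"  (infixr \<open>*\<^sub>C\<close> 75)
  assumes scaleR_scaleC: "r *\<^sub>R x = complex_of_real r *\<^sub>C x"

class complex_vector = scaleC + ab_group_add +
  assumes scaleC_add_right: "a *\<^sub>C (x + y) = a *\<^sub>C x + a *\<^sub>C y"
    and scaleC_add_left: "(a + b) *\<^sub>C x = a *\<^sub>C x + b *\<^sub>C x"
    and scaleC_scaleC: "a *\<^sub>C b *\<^sub>C x = (a * b) *\<^sub>C x"
    and scaleC_one: "1 *\<^sub>C x = x"

class complex_normed_vector = complex_vector + real_normed_vector +
  assumes norm_scaleC: "norm (a *\<^sub>C x) = cmod a * norm x"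

class cbanach = complex_normed_vector + banach

instantiation complex :: complex_normed_vector
begin

definition scaleC_complex :: "complex \<Rightarrow> complex \<Rightarrow> complex"
  where "scaleC_complex a x = a * x"

instance
  by standard (simp_all add: scaleC_complex_def scaleR_conv_of_real algebra_simps norm_mult)

end

instance complex :: cbanach ..


section \<open>Bounded complex-linear operators\<close>

definition bounded_clinear :: "('a::complex_normed_vector \<Rightarrow> 'b::complex_normed_vector) \<Rightarrow> bool"
  where "bounded_clinear f \<longleftrightarrow> bounded_linear f \<and> (\<forall>c x. f (c *\<^sub>C x) = c *\<^sub>C f x)"

lemma bounded_clinear_imp_bounded_linear: "bounded_clinear f \<Longrightarrow> bounded_linear f"
  by (simp add: bounded_clinear_def)

lemma scaleC_zero_right [simp]: "c *\<^sub>C (0::'a::complex_vector) = 0"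
  by (metis add_cancel_right_right scaleC_add_right)

lemma scaleC_minus_right: "c *\<^sub>C (- x) = - (c *\<^sub>C (x::'a::complex_vector))"
  by (metis add.right_inverse add_eq_0_iff scaleC_add_right scaleC_zero_right)

lemma scaleC_diff_right: "c *\<^sub>C (x - y) = c *\<^sub>C x - c *\<^sub>C (y::'a::complex_vector)"
  by (metis scaleC_add_right scaleC_minus_right diff_conv_add_uminus)

lemma bounded_linear_scaleC_right:
  "bounded_linear (\<lambda>x::'a::complex_normed_vector. c *\<^sub>C x)"
  by (rule bounded_linear_intro[where K = "cmod c"])
    (simp_all add: scaleC_add_right scaleR_scaleC scaleC_scaleC norm_scaleC mult.commute)

typedef (overloaded) ('a, 'b) cblinfun (\<open>(_ \<Rightarrow>\<^sub>C\<^sub>L /_)\<close> [22, 21] 21) =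
  "{f :: 'a::complex_normed_vector \<Rightarrow> 'b::complex_normed_vector. bounded_clinear f}"
  morphisms cblinfun_apply CBlinfun
  by (rule exI[where x = "\<lambda>_. 0"]) (simp add: bounded_clinear_def)

setup_lifting type_definition_cblinfun

instantiation cblinfun :: (complex_normed_vector, complex_normed_vector) complex_normed_vector
begin

lift_definition norm_cblinfun :: "('a \<Rightarrow>\<^sub>C\<^sub>L 'b) \<Rightarrow> real" is onorm .

lift_definition zero_cblinfun :: "'a \<Rightarrow>\<^sub>C\<^sub>L 'b" is "\<lambda>_. 0"
  by (simp add: bounded_clinear_def)

lift_definition plus_cblinfun :: "('a \<Rightarrow>\<^sub>C\<^sub>L 'b) \<Rightarrow> ('a \<Rightarrow>\<^sub>C\<^sub>L 'b) \<Rightarrow> ('a \<Rightarrow>\<^sub>C\<^sub>L 'b)"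
  is "\<lambda>f g x. f x + g x"
  by (simp add: bounded_clinear_def bounded_linear_add scaleC_add_right)

lift_definition uminus_cblinfun :: "('a \<Rightarrow>\<^sub>C\<^sub>L 'b) \<Rightarrow> ('a \<Rightarrow>\<^sub>C\<^sub>L 'b)" is "\<lambda>f x. - f x"
  by (simp add: bounded_clinear_def bounded_linear_minus scaleC_minus_right)

lift_definition minus_cblinfun :: "('a \<Rightarrow>\<^sub>C\<^sub>L 'b) \<Rightarrow> ('a \<Rightarrow>\<^sub>C\<^sub>L 'b) \<Rightarrow> ('a \<Rightarrow>\<^sub>C\<^sub>L 'b)"
  is "\<lambda>f g x. f x - g x"
  by (simp add: bounded_clinear_def bounded_linear_sub scaleC_diff_right)

lift_definition scaleR_cblinfun :: "real \<Rightarrow> ('a \<Rightarrow>\<^sub>C\<^sub>L 'b) \<Rightarrow> ('a \<Rightarrow>\<^sub>C\<^sub>L 'b)" is "\<lambda>r f x. r *\<^sub>R f x"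
  by (auto simp: bounded_clinear_def scaleR_scaleC scaleC_scaleC mult.commute
      intro: bounded_linear_compose[OF bounded_linear_scaleC_right])

lift_definition scaleC_cblinfun :: "complex \<Rightarrow> ('a \<Rightarrow>\<^sub>C\<^sub>L 'b) \<Rightarrow> ('a \<Rightarrow>\<^sub>C\<^sub>L 'b)" is "\<lambda>c f x. c *\<^sub>C f x"
  by (auto simp: bounded_clinear_def scaleC_scaleC mult.commute
      intro: bounded_linear_compose[OF bounded_linear_scaleC_right])

definition dist_cblinfun :: "('a \<Rightarrow>\<^sub>C\<^sub>L 'b) \<Rightarrow> ('a \<Rightarrow>\<^sub>C\<^sub>L 'b) \<Rightarrow> real"
  where "dist_cblinfun f g = norm (f - g)"

definition [code del]: "(uniformity :: (('a \<Rightarrow>\<^sub>C\<^sub>L 'b) \<times> ('a \<Rightarrow>\<^sub>C\<^sub>L 'b)) filter) =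
  (INF e\<in>{0<..}. principal {(f, g). dist f g < e})"

definition open_cblinfun :: "('a \<Rightarrow>\<^sub>C\<^sub>L 'b) set \<Rightarrow> bool"
  where [code del]: "open_cblinfun S = (\<forall>f\<in>S. \<forall>\<^sub>F (f', g) in uniformity. f' = f \<longrightarrow> g \<in> S)"

definition sgn_cblinfun :: "('a \<Rightarrow>\<^sub>C\<^sub>L 'b) \<Rightarrow> ('a \<Rightarrow>\<^sub>C\<^sub>L 'b)"
  where "sgn_cblinfun f = inverse (norm f) *\<^sub>R f"

lemma onorm_scaleC_le:
  assumes "bounded_clinear (f :: 'a \<Rightarrow> 'b)"
  shows "onorm (\<lambda>x. c *\<^sub>C f x) \<le> cmod c * onorm f"
proof (rule onorm_bound)
  have f: "bounded_linear f" using assms by (rule bounded_clinear_imp_bounded_linear)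
  show "0 \<le> cmod c * onorm f" by (simp add: onorm_pos_le[OF f])
  show "norm (c *\<^sub>C f x) \<le> cmod c * onorm f * norm x" for x
    by (simp add: norm_scaleC mult.assoc mult_left_mono onorm[OF f])
qed

lemma onorm_scaleC:
  assumes "bounded_clinear (f :: 'a \<Rightarrow> 'b)"
  shows "onorm (\<lambda>x. c *\<^sub>C f x) = cmod c * onorm f"
proof (cases "c = 0")
  case True
  have "(0::complex) *\<^sub>C y = 0" for y :: 'b
    using scaleR_scaleC[of 0 y] by simp
  then show ?thesis using True by (simp add: onorm_zero)
next
  case False
  have cf: "bounded_clinear (\<lambda>x. c *\<^sub>C f x)"
    using assms by (auto simp: bounded_clinear_def scaleC_scaleC mult.commute
        intro: bounded_linear_compose[OF bounded_linear_scaleC_right])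
  have "onorm f = onorm (\<lambda>x. inverse c *\<^sub>C c *\<^sub>C f x)"
    using False by (simp add: scaleC_scaleC scaleC_one)
  also have "\<dots> \<le> cmod (inverse c) * onorm (\<lambda>x. c *\<^sub>C f x)"
    by (rule onorm_scaleC_le[OF cf])
  finally have "cmod c * onorm f \<le> onorm (\<lambda>x. c *\<^sub>C f x)"
    using False by (simp add: norm_divide field_simps)
  then show ?thesis using onorm_scaleC_le[OF assms, of c] by simp
qed

instance
proof
  fix f g h :: "'a \<Rightarrow>\<^sub>C\<^sub>L 'b" and a b :: complex and r s :: real
  show "r *\<^sub>R f = complex_of_real r *\<^sub>C f" by transfer (simp add: scaleR_scaleC)
  show "f + g + h = f + (g + h)" by transfer (simp add: add.assoc)
  show "f + g = g + f" by transfer (simp add: add.commute)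
  show "0 + f = f" by transfer simp
  show "- f + f = 0" by transfer simp
  show "f - g = f + - g" by transfer simp
  show "a *\<^sub>C (f + g) = a *\<^sub>C f + a *\<^sub>C g" by transfer (simp add: scaleC_add_right)
  show "(a + b) *\<^sub>C f = a *\<^sub>C f + b *\<^sub>C f" by transfer (simp add: scaleC_add_left)
  show "a *\<^sub>C b *\<^sub>C f = (a * b) *\<^sub>C f" by transfer (simp add: scaleC_scaleC)
  show "1 *\<^sub>C f = f" by transfer (simp add: scaleC_one)
  show "r *\<^sub>R (f + g) = r *\<^sub>R f + r *\<^sub>R g" by transfer (simp add: scaleR_add_right)
  show "(r + s) *\<^sub>R f = r *\<^sub>R f + s *\<^sub>R f" by transfer (simp add: scaleR_add_left)
  show "r *\<^sub>R s *\<^sub>R f = (r * s) *\<^sub>R f" by transfer simp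
  show "1 *\<^sub>R f = f" by transfer simp
  show "dist f g = norm (f - g)" by (fact dist_cblinfun_def)
  show "sgn f = inverse (norm f) *\<^sub>R f" by (fact sgn_cblinfun_def)
  show "uniformity = (INF e\<in>{0<..}. principal {(f, g :: 'a \<Rightarrow>\<^sub>C\<^sub>L 'b). dist f g < e})"
    by (fact uniformity_cblinfun_def)
  show "open U = (\<forall>f\<in>U. \<forall>\<^sub>F (f', g) in uniformity. f' = f \<longrightarrow> g \<in> U)"
    for U :: "('a \<Rightarrow>\<^sub>C\<^sub>L 'b) set" by (fact open_cblinfun_def)
  show "(norm f = 0) = (f = 0)"
    by transfer (auto simp: onorm_eq_0 bounded_clinear_def)
  show "norm (f + g) \<le> norm f + norm g"
    by transfer (simp add: onorm_triangle bounded_clinear_def)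
  show "norm (r *\<^sub>R f) = \<bar>r\<bar> * norm f"
    by transfer (simp add: onorm_scaleR bounded_clinear_def)
  show "norm (a *\<^sub>C f) = cmod a * norm f"
    by transfer (simp add: onorm_scaleC)
qed

end

declare uniformity_Abort[where 'a = "('a::complex_normed_vector) \<Rightarrow>\<^sub>C\<^sub>L ('b::complex_normed_vector)", code]

type_synonym 'a cdual = "'a \<Rightarrow>\<^sub>C\<^sub>L complex"


section \<open>Gaussian sums\<close>

text \<open>The standard complex Gaussian law is normalised so that the second absolute moment is 1:
  real and imaginary part are independent centred Gaussians of variance 1/2.\<close>

definition complex_std_gaussian :: "'w measure \<Rightarrow> ('w \<Rightarrow> complex) \<Rightarrow> bool"
  where "complex_std_gaussian M g \<longleftrightarrow>
    prob_space.indep_var M borel (\<lambda>\<omega>. Re (g \<omega>)) borel (\<lambda>\<omega>. Im (g \<omega>)) \<and>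
    distributed M lborel (\<lambda>\<omega>. Re (g \<omega>)) (\<lambda>x. ennreal (normal_density 0 (sqrt (1/2)) x)) \<and>
    distributed M lborel (\<lambda>\<omega>. Im (g \<omega>)) (\<lambda>x. ennreal (normal_density 0 (sqrt (1/2)) x))"

locale complex_gaussian_sequence = prob_space M
  for M :: "'w measure" +
  fixes \<gamma> :: "nat \<Rightarrow> 'w \<Rightarrow> complex"
  assumes indep_gaussian: "indep_vars (\<lambda>_. borel) \<gamma> UNIV"
    and std_gaussian: "complex_std_gaussian M (\<gamma> n)"

text \<open>The norm in \<open>L\<^sup>2(M, X)\<close> of the finite sum of the \<open>\<gamma> n \<otimes> x n\<close> over \<open>n < N\<close>, that is, its norm
  in the Gaussian space \<open>G(X)\<close>.\<close>

definition gauss_norm ::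
    "'w measure \<Rightarrow> (nat \<Rightarrow> 'w \<Rightarrow> complex) \<Rightarrow> nat \<Rightarrow> (nat \<Rightarrow> 'a::complex_normed_vector) \<Rightarrow> real"
  where "gauss_norm M \<gamma> N x = sqrt (\<integral>\<omega>. (norm (\<Sum>n<N. \<gamma> n \<omega> *\<^sub>C x n))\<^sup>2 \<partial>M)"

definition gamma_bounded ::
    "'w measure \<Rightarrow> (nat \<Rightarrow> 'w \<Rightarrow> complex) \<Rightarrow> ('a::cbanach \<Rightarrow>\<^sub>C\<^sub>L 'a) set \<Rightarrow> bool"
  where "gamma_bounded M \<gamma> \<T> \<longleftrightarrow>
    (\<exists>C\<ge>0. \<forall>N (T :: nat \<Rightarrow> 'a \<Rightarrow>\<^sub>C\<^sub>L 'a) (x :: nat \<Rightarrow> 'a). (\<forall>n<N. T n \<in> \<T>) \<longrightarrow>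
      gauss_norm M \<gamma> N (\<lambda>n. cblinfun_apply (T n) (x n)) \<le> C * gauss_norm M \<gamma> N x)"

text \<open>The supremum is taken in \<^typ>\<open>ereal\<close>, so that it needs no boundedness side condition.\<close>

definition K_convex :: "'w measure \<Rightarrow> (nat \<Rightarrow> 'w \<Rightarrow> complex) \<Rightarrow> 'a::cbanach itself \<Rightarrow> bool"
  where "K_convex M \<gamma> (_ :: 'a itself) \<longleftrightarrow>
    (\<exists>K>0. \<forall>N (x :: nat \<Rightarrow> 'a).
      ereal (gauss_norm M \<gamma> N x) \<le>
        ereal K * (SUP y \<in> {y :: nat \<Rightarrow> 'a cdual. gauss_norm M \<gamma> N y \<le> 1}.
          ereal (cmod (\<Sum>n<N. cblinfun_apply (y n) (x n)))))"


section \<open>Semigroups of operators\<close>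

definition C0_semigroup :: "(real \<Rightarrow> 'a::cbanach \<Rightarrow>\<^sub>C\<^sub>L 'a) \<Rightarrow> bool"
  where "C0_semigroup T \<longleftrightarrow>
    (\<forall>x. cblinfun_apply (T 0) x = x) \<and>
    (\<forall>s\<ge>0. \<forall>t\<ge>0. \<forall>x. cblinfun_apply (T (s + t)) x = cblinfun_apply (T s) (cblinfun_apply (T t) x)) \<and>
    (\<forall>x. ((\<lambda>t. cblinfun_apply (T t) x) \<longlongrightarrow> x) (at_right 0))"

end

theory Submission
  imports Defs
begin

text \<open>Every single operator is \<open>\<gamma>\<close>-bounded, with its norm as constant, and a union of countably many
  \<open>\<gamma>\<close>-bounded sets is \<open>\<gamma>\<close>-bounded as soon as their constants are summable.  Given this, write
  \<open>t = k + s\<close> with \<open>k\<close> a natural number and \<open>0 \<le> s < 1\<close>.  The semigroup law yields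
  \<open>exp (- \<delta> * t) T\<^sub>t = exp (- \<delta> * k) T\<^sub>k (exp (- \<delta> * s) T\<^sub>s)\<close>.  The operators \<open>T\<^sub>s\<close> with \<open>s < 1\<close>
  form a \<open>\<gamma>\<close>-bounded set, because for them the weight \<open>exp (- \<delta>\<^sub>0 * s)\<close> of the hypothesis stays
  above \<open>exp (- \<delta>\<^sub>0)\<close>, and the \<open>T\<^sub>k\<close> are uniformly bounded.  Hence the operators with
  \<open>k \<le> t < k + 1\<close> form a \<open>\<gamma>\<close>-bounded set whose constant is a fixed multiple of \<open>exp (- \<delta> * k)\<close>,
  and these constants form a convergent geometric series for every \<open>\<delta> > 0\<close>.

  The statement on unions rests on two properties of the Gaussian norm: the triangle inequality and
  the contraction principle \<open>gauss_norm_contract\<close> for real scalars in \<open>[-1, 1]\<close>.  The latter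
  follows from the former by convexity, since changing the sign of one Gaussian variable
  does not change the joint law.\<close>

section \<open>Complex linear operators\<close>

lemma cblinfun_linear: "bounded_linear (cblinfun_apply f)"
  by transfer (simp add: bounded_clinear_def)

lemma cblinfun_scaleC: "cblinfun_apply f (c *\<^sub>C x) = c *\<^sub>C cblinfun_apply f x"
  by transfer (simp add: bounded_clinear_def)

lemma norm_cblinfun_apply_le: "norm (cblinfun_apply f x) \<le> norm f * norm x"
  by transfer (simp add: bounded_clinear_def onorm)

section \<open>Symmetry of the Gaussian law\<close>

context prob_space
begin

lemma complex_std_gaussian_measurable:
  assumes "complex_std_gaussian M g"
  shows "g \<in> borel_measurable M"
proof -
  have "(\<lambda>\<omega>. Re (g \<omega>)) \<in> borel_measurable M" "(\<lambda>\<omega>. Im (g \<omega>)) \<in> borel_measurable M"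
    using assms by (auto simp: complex_std_gaussian_def dest: distributed_measurable)
  then show ?thesis
    by (simp add: borel_measurable_complex_iff)
qed

lemma complex_std_gaussian_uminus:
  assumes "complex_std_gaussian M g"
  shows "complex_std_gaussian M (\<lambda>\<omega>. - g \<omega>)"
proof -
  have neg: "distributed M lborel (\<lambda>\<omega>. - X \<omega>) (\<lambda>x. ennreal (normal_density 0 (sqrt (1/2)) x))"
    if "distributed M lborel X (\<lambda>x. ennreal (normal_density 0 (sqrt (1/2)) x))" for X
    using normal_density_affine[OF that, of "-1" 0] by simp
  have "indep_var borel ((\<lambda>x. - x) \<circ> (\<lambda>\<omega>. Re (g \<omega>))) borel ((\<lambda>x. - x) \<circ> (\<lambda>\<omega>. Im (g \<omega>)))"
    using assms by (intro indep_var_compose[where ?M1.0=borel and ?M2.0=borel])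
      (auto simp: complex_std_gaussian_def)
  then show ?thesis
    using assms neg by (auto simp: complex_std_gaussian_def comp_def)
qed

lemma complex_std_gaussian_distr_unique:
  assumes "complex_std_gaussian M g" and "complex_std_gaussian M h"
  shows "distr M borel g = distr M borel h"
proof -
  define D where "D = density lborel (\<lambda>x. ennreal (normal_density 0 (sqrt (1/2)) x))"
  have law: "distr M borel f = distr (D \<Otimes>\<^sub>M D) borel (\<lambda>p. Complex (fst p) (snd p))"
    if f: "complex_std_gaussian M f" for f
  proof -
    have ind: "indep_var borel (\<lambda>\<omega>. Re (f \<omega>)) borel (\<lambda>\<omega>. Im (f \<omega>))"
      and Re: "distributed M lborel (\<lambda>\<omega>. Re (f \<omega>)) (\<lambda>x. ennreal (normal_density 0 (sqrt (1/2)) x))"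
      and Im: "distributed M lborel (\<lambda>\<omega>. Im (f \<omega>)) (\<lambda>x. ennreal (normal_density 0 (sqrt (1/2)) x))"
      using f by (auto simp: complex_std_gaussian_def)
    have ReD: "distr M borel (\<lambda>\<omega>. Re (f \<omega>)) = D"
      using distributed_distr_eq_density[OF Re] unfolding D_def
      by (metis distr_cong sets_lborel)
    have ImD: "distr M borel (\<lambda>\<omega>. Im (f \<omega>)) = D"
      using distributed_distr_eq_density[OF Im] unfolding D_def
      by (metis distr_cong sets_lborel)
    have rv: "(\<lambda>\<omega>. Re (f \<omega>)) \<in> borel_measurable M" "(\<lambda>\<omega>. Im (f \<omega>)) \<in> borel_measurable M"
      and pair: "D \<Otimes>\<^sub>M D = distr M (borel \<Otimes>\<^sub>M borel) (\<lambda>\<omega>. (Re (f \<omega>), Im (f \<omega>)))"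
      using ind unfolding indep_var_distribution_eq ReD ImD by auto
    have C: "(\<lambda>p. Complex (fst p) (snd p)) \<in> (borel \<Otimes>\<^sub>M borel) \<rightarrow>\<^sub>M borel"
      by (simp add: borel_measurable_complex_iff)
    show ?thesis
      unfolding pair using rv C by (subst distr_distr) (auto simp: comp_def)
  qed
  show ?thesis
    using law assms by simp
qed

end

context complex_gaussian_sequence
begin

lemma gaussian_measurable: "\<gamma> n \<in> borel_measurable M"
  using complex_std_gaussian_measurable[OF std_gaussian] .

lemma gaussian_square_integrable: "integrable M (\<lambda>\<omega>. (cmod (\<gamma> n \<omega>))\<^sup>2)"
proof -
  have sq: "integrable M (\<lambda>\<omega>. (X \<omega>)\<^sup>2)"
    if X: "distributed M lborel X (\<lambda>x. ennreal (normal_density 0 (sqrt (1/2)) x))" for X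
    using integrable_normal_moment[of "sqrt (1/2)" 0 2]
      distributed_integrable[OF X, of "\<lambda>x. x\<^sup>2"] by simp
  show ?thesis
    using std_gaussian[of n] by (auto simp: cmod_power2 complex_std_gaussian_def intro!: sq)
qed

text \<open>The joint law of an independent family is the product of its marginal laws, and negating one
  variable leaves both the independence and the marginal laws unchanged.\<close>

lemma gaussian_flip_distr:
  fixes F :: "(nat \<Rightarrow> complex) \<Rightarrow> real"
  assumes F: "F \<in> borel_measurable borel"
  shows "(\<integral>\<omega>. F (\<lambda>n. if n = j then - \<gamma> n \<omega> else \<gamma> n \<omega>) \<partial>M) = (\<integral>\<omega>. F (\<lambda>n. \<gamma> n \<omega>) \<partial>M)"
proof -
  define \<gamma>' where "\<gamma>' n \<omega> = (if n = j then - \<gamma> n \<omega> else \<gamma> n \<omega>)" for n \<omega>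
  have std': "complex_std_gaussian M (\<gamma>' n)" for n
    using complex_std_gaussian_uminus[OF std_gaussian] std_gaussian
    by (cases "n = j") (auto simp: \<gamma>'_def[abs_def])
  have "indep_vars (\<lambda>_. borel) (\<lambda>n \<omega>. (if n = j then uminus else id) (\<gamma> n \<omega>)) UNIV"
    by (rule indep_vars_compose2[OF indep_gaussian]) auto
  then have ind': "indep_vars (\<lambda>_. borel) \<gamma>' UNIV"
    by (rule back_subst[where P="\<lambda>X. indep_vars (\<lambda>_. borel) X UNIV"]) (auto simp: \<gamma>'_def fun_eq_iff)
  let ?P = "PiM UNIV (\<lambda>_::nat. borel :: complex measure)"
  have law: "(\<integral>\<omega>. F (\<lambda>n. X n \<omega>) \<partial>M) = integral\<^sup>L (PiM UNIV (\<lambda>n. distr M borel (X n))) F"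
    if std: "\<And>n. complex_std_gaussian M (X n)" and ind: "indep_vars (\<lambda>_. borel) X UNIV" for X
  proof -
    have rv: "X n \<in> borel_measurable M" for n
      using complex_std_gaussian_measurable[OF std] .
    have "distr M ?P (\<lambda>\<omega> n. X n \<omega>) = PiM UNIV (\<lambda>n. distr M borel (X n))"
      using iffD1[OF indep_vars_iff_distr_eq_PiM[OF UNIV_not_empty rv] ind] by (simp add: restrict_def)
    then have "integral\<^sup>L (PiM UNIV (\<lambda>n. distr M borel (X n))) F
        = integral\<^sup>L (distr M ?P (\<lambda>\<omega> n. X n \<omega>)) F"
      by simp
    also have "\<dots> = (\<integral>\<omega>. F (\<lambda>n. X n \<omega>) \<partial>M)"
    proof (rule integral_distr)
      show "(\<lambda>\<omega> n. X n \<omega>) \<in> M \<rightarrow>\<^sub>M ?P"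
        using rv by (intro measurable_PiM_single') auto
      show "F \<in> borel_measurable ?P"
        using F by (simp cong: measurable_cong_sets add: sets_PiM_equal_borel)
    qed
    finally show ?thesis by simp
  qed
  have "distr M borel (\<gamma>' n) = distr M borel (\<gamma> n)" for n
    by (rule complex_std_gaussian_distr_unique[OF std' std_gaussian])
  then show ?thesis
    using law[OF std' ind'] law[OF std_gaussian indep_gaussian] by (simp add: \<gamma>'_def)
qed

section \<open>The Gaussian norm\<close>

text \<open>The usual closure of measurable functions under sums needs a second countable range, which
  a general Banach space is not.  So the measurability is obtained by composing the sequence of the \<open>\<gamma> n\<close>,
  which takes values in the second countable space \<open>nat \<Rightarrow> complex\<close>, with a continuous
  real-valued function.\<close>

lemma gauss_sum_norm_measurable:
  fixes x :: "nat \<Rightarrow> 'a::complex_normed_vector"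
  shows "(\<lambda>f::nat \<Rightarrow> complex. (norm (\<Sum>n<N. f n *\<^sub>C x n))\<^sup>2) \<in> borel_measurable borel"
    and "(\<lambda>\<omega>. (norm (\<Sum>n<N. \<gamma> n \<omega> *\<^sub>C x n))\<^sup>2) \<in> borel_measurable M"
proof -
  have lin: "bounded_linear (\<lambda>c. c *\<^sub>C y)" for y :: 'a
    by (rule bounded_linear_intro[where K = "norm y"])
      (simp_all add: scaleC_add_left scaleR_scaleC scaleC_scaleC norm_scaleC scaleC_complex_def)
  have "continuous_on UNIV (\<lambda>f::nat \<Rightarrow> complex. (norm (\<Sum>n<N. f n *\<^sub>C x n))\<^sup>2)"
    by (intro continuous_intros bounded_linear.continuous_on[OF lin]) auto
  then show *: "(\<lambda>f::nat \<Rightarrow> complex. (norm (\<Sum>n<N. f n *\<^sub>C x n))\<^sup>2) \<in> borel_measurable borel"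
    by (rule borel_measurable_continuous_onI)
  have "(\<lambda>\<omega> n. \<gamma> n \<omega>) \<in> borel_measurable M"
    by (intro measurable_coordinatewise_then_product gaussian_measurable)
  from measurable_compose[OF this *]
  show "(\<lambda>\<omega>. (norm (\<Sum>n<N. \<gamma> n \<omega> *\<^sub>C x n))\<^sup>2) \<in> borel_measurable M" .
qed

lemma gauss_sum_square_integrable:
  fixes x :: "nat \<Rightarrow> 'a::complex_normed_vector"
  shows "integrable M (\<lambda>\<omega>. (norm (\<Sum>n<N. \<gamma> n \<omega> *\<^sub>C x n))\<^sup>2)"
proof (rule Bochner_Integration.integrable_bound)
  show "integrable M (\<lambda>\<omega>. (\<Sum>n<N. (cmod (\<gamma> n \<omega>))\<^sup>2) * (\<Sum>n<N. (norm (x n))\<^sup>2))"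
    by (intro integrable_mult_left Bochner_Integration.integrable_sum gaussian_square_integrable)
  show "AE \<omega> in M. norm ((norm (\<Sum>n<N. \<gamma> n \<omega> *\<^sub>C x n))\<^sup>2)
      \<le> norm ((\<Sum>n<N. (cmod (\<gamma> n \<omega>))\<^sup>2) * (\<Sum>n<N. (norm (x n))\<^sup>2))"
  proof (rule AE_I2)
    fix \<omega>
    have "norm (\<Sum>n<N. \<gamma> n \<omega> *\<^sub>C x n) \<le> (\<Sum>n<N. cmod (\<gamma> n \<omega>) * norm (x n))"
      by (rule sum_norm_le) (simp add: norm_scaleC)
    then have "(norm (\<Sum>n<N. \<gamma> n \<omega> *\<^sub>C x n))\<^sup>2 \<le> (\<Sum>n<N. cmod (\<gamma> n \<omega>) * norm (x n))\<^sup>2"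
      by (intro power_mono) auto
    also have "\<dots> \<le> (\<Sum>n<N. (cmod (\<gamma> n \<omega>))\<^sup>2) * (\<Sum>n<N. (norm (x n))\<^sup>2)"
      by (rule Cauchy_Schwarz_ineq_sum)
    finally show "norm ((norm (\<Sum>n<N. \<gamma> n \<omega> *\<^sub>C x n))\<^sup>2)
        \<le> norm ((\<Sum>n<N. (cmod (\<gamma> n \<omega>))\<^sup>2) * (\<Sum>n<N. (norm (x n))\<^sup>2))"
      by simp
  qed
qed (rule gauss_sum_norm_measurable)

lemma gauss_norm_nonneg: "0 \<le> gauss_norm M \<gamma> N x"
  by (simp add: gauss_norm_def)

lemma gauss_norm_power2:
  "(gauss_norm M \<gamma> N x)\<^sup>2 = (\<integral>\<omega>. (norm (\<Sum>n<N. \<gamma> n \<omega> *\<^sub>C x n))\<^sup>2 \<partial>M)"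
  by (simp add: gauss_norm_def)

lemma gauss_norm_cong:
  "(\<And>n. n < N \<Longrightarrow> x n = y n) \<Longrightarrow> gauss_norm M \<gamma> N x = gauss_norm M \<gamma> N y"
  by (simp add: gauss_norm_def)

lemma gauss_norm_zero: "gauss_norm M \<gamma> N (\<lambda>_. 0) = 0"
  by (simp add: gauss_norm_def)

lemma gauss_norm_cblinfun_apply_le:
  "gauss_norm M \<gamma> N (\<lambda>n. cblinfun_apply U (x n)) \<le> norm U * gauss_norm M \<gamma> N x"
proof (rule power2_le_imp_le)
  have eq: "(\<Sum>n<N. \<gamma> n \<omega> *\<^sub>C cblinfun_apply U (x n)) = cblinfun_apply U (\<Sum>n<N. \<gamma> n \<omega> *\<^sub>C x n)" for \<omega>
    by (simp add: cblinfun_scaleC linear_sum[OF bounded_linear.linear[OF cblinfun_linear]])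
  have "(\<integral>\<omega>. (norm (\<Sum>n<N. \<gamma> n \<omega> *\<^sub>C cblinfun_apply U (x n)))\<^sup>2 \<partial>M)
      \<le> (\<integral>\<omega>. (norm U)\<^sup>2 * (norm (\<Sum>n<N. \<gamma> n \<omega> *\<^sub>C x n))\<^sup>2 \<partial>M)"
  proof (rule integral_mono)
    show "(norm (\<Sum>n<N. \<gamma> n \<omega> *\<^sub>C cblinfun_apply U (x n)))\<^sup>2
        \<le> (norm U)\<^sup>2 * (norm (\<Sum>n<N. \<gamma> n \<omega> *\<^sub>C x n))\<^sup>2" for \<omega>
      unfolding eq power_mult_distrib[symmetric] by (intro power_mono norm_cblinfun_apply_le) simp
  qed (auto intro: gauss_sum_square_integrable)
  then show "(gauss_norm M \<gamma> N (\<lambda>n. cblinfun_apply U (x n)))\<^sup>2 \<le> (norm U * gauss_norm M \<gamma> N x)\<^sup>2"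
    by (simp add: power_mult_distrib gauss_norm_power2)
qed (simp add: gauss_norm_nonneg)

text \<open>For positive \<open>p\<close> and \<open>q\<close>, convexity of the square gives
  \<open>(a + b)\<^sup>2 \<le> (p + q) * (a\<^sup>2 / p + b\<^sup>2 / q)\<close>.  Integrating this with \<open>p\<close> and \<open>q\<close> slightly
  larger than the two norms avoids the degenerate cases where one of them vanishes.\<close>

lemma gauss_norm_triangle:
  fixes x y :: "nat \<Rightarrow> 'a::complex_normed_vector"
  shows "gauss_norm M \<gamma> N (\<lambda>n. x n + y n) \<le> gauss_norm M \<gamma> N x + gauss_norm M \<gamma> N y"
proof (rule field_le_epsilon)
  fix e :: real assume e: "0 < e"
  define p q where "p = gauss_norm M \<gamma> N x + e / 2" and "q = gauss_norm M \<gamma> N y + e / 2"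
  have p: "0 < p" "gauss_norm M \<gamma> N x \<le> p" and q: "0 < q" "gauss_norm M \<gamma> N y \<le> q"
    using e gauss_norm_nonneg[of N x] gauss_norm_nonneg[of N y] by (auto simp: p_def q_def)
  have convex: "(a + b)\<^sup>2 \<le> (p + q) / p * a\<^sup>2 + (p + q) / q * b\<^sup>2" for a b
  proof -
    have "(p + q) / p * a\<^sup>2 + (p + q) / q * b\<^sup>2 - (a + b)\<^sup>2 = (q * a - p * b)\<^sup>2 / (p * q)"
      using p q by (simp add: field_simps power2_eq_square)
    moreover have "0 \<le> (q * a - p * b)\<^sup>2 / (p * q)"
      using p q by simp
    ultimately show ?thesis by linarith
  qed
  have "gauss_norm M \<gamma> N (\<lambda>n. x n + y n) \<le> p + q"
  proof (rule power2_le_imp_le)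
    have "(gauss_norm M \<gamma> N (\<lambda>n. x n + y n))\<^sup>2
        \<le> (\<integral>\<omega>. (p + q) / p * (norm (\<Sum>n<N. \<gamma> n \<omega> *\<^sub>C x n))\<^sup>2
              + (p + q) / q * (norm (\<Sum>n<N. \<gamma> n \<omega> *\<^sub>C y n))\<^sup>2 \<partial>M)"
      unfolding gauss_norm_power2
    proof (rule integral_mono)
      fix \<omega>
      have "(norm (\<Sum>n<N. \<gamma> n \<omega> *\<^sub>C (x n + y n)))\<^sup>2
          \<le> (norm (\<Sum>n<N. \<gamma> n \<omega> *\<^sub>C x n) + norm (\<Sum>n<N. \<gamma> n \<omega> *\<^sub>C y n))\<^sup>2"
        by (intro power_mono) (auto simp: scaleC_add_right sum.distrib norm_triangle_ineq)
      also note convex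
      finally show "(norm (\<Sum>n<N. \<gamma> n \<omega> *\<^sub>C (x n + y n)))\<^sup>2
          \<le> (p + q) / p * (norm (\<Sum>n<N. \<gamma> n \<omega> *\<^sub>C x n))\<^sup>2
              + (p + q) / q * (norm (\<Sum>n<N. \<gamma> n \<omega> *\<^sub>C y n))\<^sup>2" .
    qed (intro gauss_sum_square_integrable Bochner_Integration.integrable_add integrable_mult_right)+
    also have "\<dots> = (p + q) / p * (gauss_norm M \<gamma> N x)\<^sup>2 + (p + q) / q * (gauss_norm M \<gamma> N y)\<^sup>2"
      by (simp add: gauss_norm_power2 gauss_sum_square_integrable)
    also have "\<dots> \<le> (p + q) / p * p\<^sup>2 + (p + q) / q * q\<^sup>2"
      using p q by (intro add_mono mult_left_mono power_mono gauss_norm_nonneg) auto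
    also have "\<dots> = (p + q)\<^sup>2"
      using p q by (simp add: field_simps power2_eq_square)
    finally show "(gauss_norm M \<gamma> N (\<lambda>n. x n + y n))\<^sup>2 \<le> (p + q)\<^sup>2" .
  qed (use p q in simp)
  then show "gauss_norm M \<gamma> N (\<lambda>n. x n + y n) \<le> gauss_norm M \<gamma> N x + gauss_norm M \<gamma> N y + e"
    by (simp add: p_def q_def)
qed

lemma gauss_norm_sum_le:
  assumes "finite A"
  shows "gauss_norm M \<gamma> N (\<lambda>n. \<Sum>k\<in>A. y k n) \<le> (\<Sum>k\<in>A. gauss_norm M \<gamma> N (y k))"
  using assms
proof (induction A rule: finite_induct)
  case empty
  then show ?case by (simp add: gauss_norm_zero)
next
  case (insert k A)
  then show ?case
    using gauss_norm_triangle[of N "y k" "\<lambda>n. \<Sum>k\<in>A. y k n"] by simp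
qed

lemma gauss_norm_scaleR:
  "gauss_norm M \<gamma> N (\<lambda>n. c *\<^sub>R x n) = \<bar>c\<bar> * gauss_norm M \<gamma> N x"
proof -
  have "\<gamma> n \<omega> *\<^sub>C c *\<^sub>R x n = c *\<^sub>R \<gamma> n \<omega> *\<^sub>C x n" for n \<omega>
    by (simp add: scaleR_scaleC scaleC_scaleC mult.commute)
  then have "(\<Sum>n<N. \<gamma> n \<omega> *\<^sub>C c *\<^sub>R x n) = c *\<^sub>R (\<Sum>n<N. \<gamma> n \<omega> *\<^sub>C x n)" for \<omega>
    by (simp add: scaleR_sum_right)
  then show ?thesis
    by (simp add: gauss_norm_def power_mult_distrib real_sqrt_mult)
qed

lemma gauss_norm_flip:
  fixes x :: "nat \<Rightarrow> 'b::complex_normed_vector"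
  shows "gauss_norm M \<gamma> N (x(j := - x j)) = gauss_norm M \<gamma> N x"
proof -
  have "(\<Sum>n<N. \<gamma> n \<omega> *\<^sub>C (x(j := - x j)) n)
      = (\<Sum>n<N. (if n = j then - \<gamma> n \<omega> else \<gamma> n \<omega>) *\<^sub>C x n)" for \<omega>
  proof (rule sum.cong)
    have minus: "(- c) *\<^sub>C z = - (c *\<^sub>C z)" for c and z :: 'b
      using scaleC_scaleC[of c "-1" z] scaleR_scaleC[of "-1" z]
      by (metis mult_minus1_right of_real_1 of_real_minus scaleC_minus_right scaleR_minus1_left)
    show "\<gamma> n \<omega> *\<^sub>C (x(j := - x j)) n = (if n = j then - \<gamma> n \<omega> else \<gamma> n \<omega>) *\<^sub>C x n" for n
      by (simp add: minus scaleC_minus_right)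
  qed simp
  then show ?thesis
    using gaussian_flip_distr[OF gauss_sum_norm_measurable(1)[where N = N and x = x], of j]
    by (simp add: gauss_norm_def)
qed

text \<open>The vector with one entry scaled by \<open>c\<close> is a convex combination of the original vector and
  of the one with that entry negated.\<close>

lemma gauss_norm_scale_coordinate:
  assumes "\<bar>c\<bar> \<le> 1"
  shows "gauss_norm M \<gamma> N (x(j := c *\<^sub>R x j)) \<le> gauss_norm M \<gamma> N x"
proof -
  let ?a = "(1 + c) / 2" and ?b = "(1 - c) / 2"
  have "x(j := c *\<^sub>R x j) = (\<lambda>n. ?a *\<^sub>R x n + ?b *\<^sub>R (x(j := - x j)) n)"
    by (auto simp: fun_eq_iff scaleR_left_distrib[symmetric] scaleR_left_diff_distrib[symmetric] field_simps)
  then have "gauss_norm M \<gamma> N (x(j := c *\<^sub>R x j))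
      \<le> gauss_norm M \<gamma> N (\<lambda>n. ?a *\<^sub>R x n) + gauss_norm M \<gamma> N (\<lambda>n. ?b *\<^sub>R (x(j := - x j)) n)"
    by (metis gauss_norm_triangle)
  also have "\<dots> = \<bar>?a\<bar> * gauss_norm M \<gamma> N x + \<bar>?b\<bar> * gauss_norm M \<gamma> N x"
    by (simp only: gauss_norm_scaleR gauss_norm_flip)
  also have "\<dots> = gauss_norm M \<gamma> N x"
  proof -
    have "\<bar>?a\<bar> + \<bar>?b\<bar> = 1"
      using assms by (auto simp: abs_le_iff field_simps)
    then show ?thesis by (metis distrib_right mult_1)
  qed
  finally show ?thesis .
qed

lemma gauss_norm_contract:
  assumes a: "\<And>n. n < N \<Longrightarrow> \<bar>a n\<bar> \<le> 1"
  shows "gauss_norm M \<gamma> N (\<lambda>n. a n *\<^sub>R x n) \<le> gauss_norm M \<gamma> N x"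
proof -
  have "gauss_norm M \<gamma> N (\<lambda>n. if n < m then a n *\<^sub>R x n else x n) \<le> gauss_norm M \<gamma> N x"
    if "m \<le> N" for m
    using that
  proof (induction m)
    case 0
    then show ?case by simp
  next
    case (Suc m)
    let ?y = "\<lambda>n. if n < m then a n *\<^sub>R x n else x n"
    have "(\<lambda>n. if n < Suc m then a n *\<^sub>R x n else x n) = ?y(m := a m *\<^sub>R ?y m)"
      by (auto simp: fun_eq_iff less_Suc_eq)
    then have "gauss_norm M \<gamma> N (\<lambda>n. if n < Suc m then a n *\<^sub>R x n else x n) \<le> gauss_norm M \<gamma> N ?y"
      using gauss_norm_scale_coordinate[OF a, of m N ?y m] Suc.prems by simp
    also have "\<dots> \<le> gauss_norm M \<gamma> N x"
      using Suc by simp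
    finally show ?case .
  qed
  from this[OF order_refl] show ?thesis
    by (simp cong: gauss_norm_cong)
qed

end

section \<open>Gamma-bounds\<close>

definition gamma_bounded_with ::
    "'w measure \<Rightarrow> (nat \<Rightarrow> 'w \<Rightarrow> complex) \<Rightarrow> real \<Rightarrow> ('a::cbanach \<Rightarrow>\<^sub>C\<^sub>L 'a) set \<Rightarrow> bool"
  where "gamma_bounded_with M \<gamma> C \<T> \<longleftrightarrow> 0 \<le> C \<and>
    (\<forall>N T x. (\<forall>n<N. T n \<in> \<T>) \<longrightarrow>
      gauss_norm M \<gamma> N (\<lambda>n. cblinfun_apply (T n) (x n)) \<le> C * gauss_norm M \<gamma> N x)"

lemma gamma_bounded_iff_with: "gamma_bounded M \<gamma> \<T> \<longleftrightarrow> (\<exists>C. gamma_bounded_with M \<gamma> C \<T>)"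
  by (auto simp: gamma_bounded_def gamma_bounded_with_def)

context complex_gaussian_sequence
begin

text \<open>The effect on a \<open>\<gamma>\<close>-bound of composing with a fixed operator and of multiplying
  by varying scalars from \<open>[-1, 1]\<close>.\<close>

lemma gamma_bounded_with_factor:
  assumes S: "gamma_bounded_with M \<gamma> C \<S>"
    and factor: "\<And>R. R \<in> \<R> \<Longrightarrow>
      \<exists>S\<in>\<S>. \<exists>a. \<bar>a\<bar> \<le> 1 \<and> (\<forall>z. cblinfun_apply R z = cblinfun_apply U (cblinfun_apply S (a *\<^sub>R z)))"
  shows "gamma_bounded_with M \<gamma> (norm U * C) \<R>"
  unfolding gamma_bounded_with_def
proof (intro conjI allI impI)
  have C: "0 \<le> C" using S by (simp add: gamma_bounded_with_def)
  then show "0 \<le> norm U * C" by simp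
  fix N and R :: "nat \<Rightarrow> 'a \<Rightarrow>\<^sub>C\<^sub>L 'a" and x :: "nat \<Rightarrow> 'a"
  assume R: "\<forall>n<N. R n \<in> \<R>"
  have "\<forall>n. \<exists>S a. n < N \<longrightarrow> S \<in> \<S> \<and> \<bar>a\<bar> \<le> 1 \<and>
      (\<forall>z. cblinfun_apply (R n) z = cblinfun_apply U (cblinfun_apply S (a *\<^sub>R z)))"
    using factor R by blast
  then obtain S' a where
    S': "\<And>n. n < N \<Longrightarrow> S' n \<in> \<S>" and a: "\<And>n. n < N \<Longrightarrow> \<bar>a n :: real\<bar> \<le> 1"
    and eq: "\<And>n z. n < N \<Longrightarrow>
      cblinfun_apply (R n) z = cblinfun_apply U (cblinfun_apply (S' n) (a n *\<^sub>R z))"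
    by metis
  have "gauss_norm M \<gamma> N (\<lambda>n. cblinfun_apply (R n) (x n))
      = gauss_norm M \<gamma> N (\<lambda>n. cblinfun_apply U (cblinfun_apply (S' n) (a n *\<^sub>R x n)))"
    by (rule gauss_norm_cong) (rule eq)
  also have "\<dots> \<le> norm U * gauss_norm M \<gamma> N (\<lambda>n. cblinfun_apply (S' n) (a n *\<^sub>R x n))"
    by (rule gauss_norm_cblinfun_apply_le)
  also have "\<dots> \<le> norm U * (C * gauss_norm M \<gamma> N (\<lambda>n. a n *\<^sub>R x n))"
    using S S' by (intro mult_left_mono) (auto simp: gamma_bounded_with_def)
  also have "\<dots> \<le> norm U * (C * gauss_norm M \<gamma> N x)"
    using C a by (intro mult_left_mono gauss_norm_contract) auto
  finally show "gauss_norm M \<gamma> N (\<lambda>n. cblinfun_apply (R n) (x n)) \<le> norm U * C * gauss_norm M \<gamma> N x"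
    by (simp add: mult.assoc)
qed

text \<open>Sort the summands according to the set \<open>\<S> k\<close> from which their operator comes.  By the
  contraction principle each group of vectors has Gaussian norm at most that of
  the whole family, so the group belonging to \<open>\<S> k\<close> contributes at most \<open>C k\<close> times that norm.\<close>

lemma gamma_bounded_with_UN:
  assumes S: "\<And>k::nat. gamma_bounded_with M \<gamma> (C k) (\<S> k)"
    and C: "summable C"
  shows "gamma_bounded_with M \<gamma> (\<Sum>k. C k) (\<Union>k. \<S> k)"
  unfolding gamma_bounded_with_def
proof (intro conjI allI impI)
  have C0: "0 \<le> C k" for k
    using S by (simp add: gamma_bounded_with_def)
  then show "0 \<le> (\<Sum>k. C k)"
    by (intro suminf_nonneg C)
  fix N and T :: "nat \<Rightarrow> 'a \<Rightarrow>\<^sub>C\<^sub>L 'a" and x :: "nat \<Rightarrow> 'a"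
  assume "\<forall>n<N. T n \<in> (\<Union>k. \<S> k)"
  then have "\<forall>n. \<exists>j. n < N \<longrightarrow> T n \<in> \<S> j"
    by blast
  from choice[OF this] obtain k where k: "\<And>n. n < N \<Longrightarrow> T n \<in> \<S> (k n)"
    by blast
  define y where "y j n = (if k n = j then 1 else 0 :: real) *\<^sub>R x n" for j n
  have group: "gauss_norm M \<gamma> N (\<lambda>n. cblinfun_apply (T n) (y j n)) \<le> C j * gauss_norm M \<gamma> N x"
    if j: "j \<in> k ` {..<N}" for j
  proof -
    obtain m where m: "m < N" "k m = j" using j by auto
    \<comment> \<open>Outside the group the vectors vanish, so any element of \<open>\<S> j\<close> may act there.\<close>
    define T' where "T' n = (if k n = j then T n else T m)" for n
    have "cblinfun_apply (T n) (y j n) = cblinfun_apply (T' n) (y j n)" for n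
      by (simp add: T'_def y_def linear_0[OF bounded_linear.linear[OF cblinfun_linear]])
    moreover have "\<forall>n<N. T' n \<in> \<S> j"
      unfolding T'_def using k m by (metis (full_types))
    ultimately have "gauss_norm M \<gamma> N (\<lambda>n. cblinfun_apply (T n) (y j n)) \<le> C j * gauss_norm M \<gamma> N (y j)"
      using S[of j] by (simp add: gamma_bounded_with_def)
    also have "\<dots> \<le> C j * gauss_norm M \<gamma> N x"
      unfolding y_def[abs_def] by (intro mult_left_mono C0 gauss_norm_contract) auto
    finally show ?thesis .
  qed
  have "cblinfun_apply (T n) (x n) = (\<Sum>j\<in>k ` {..<N}. cblinfun_apply (T n) (y j n))" if "n < N" for n
  proof -
    have "(\<Sum>j\<in>k ` {..<N}. cblinfun_apply (T n) (y j n))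
        = (\<Sum>j\<in>k ` {..<N}. if k n = j then cblinfun_apply (T n) (x n) else 0)"
      by (rule sum.cong) (auto simp: y_def linear_0[OF bounded_linear.linear[OF cblinfun_linear]])
    then show ?thesis
      using that by simp
  qed
  then have "gauss_norm M \<gamma> N (\<lambda>n. cblinfun_apply (T n) (x n))
      = gauss_norm M \<gamma> N (\<lambda>n. \<Sum>j\<in>k ` {..<N}. cblinfun_apply (T n) (y j n))"
    by (rule gauss_norm_cong)
  also have "\<dots> \<le> (\<Sum>j\<in>k ` {..<N}. gauss_norm M \<gamma> N (\<lambda>n. cblinfun_apply (T n) (y j n)))"
    by (rule gauss_norm_sum_le) simp
  also have "\<dots> \<le> (\<Sum>j\<in>k ` {..<N}. C j * gauss_norm M \<gamma> N x)"
    by (rule sum_mono) (rule group)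
  also have "\<dots> = (\<Sum>j\<in>k ` {..<N}. C j) * gauss_norm M \<gamma> N x"
    by (simp add: sum_distrib_right)
  also have "\<dots> \<le> (\<Sum>k. C k) * gauss_norm M \<gamma> N x"
    by (intro mult_right_mono sum_le_suminf C C0 gauss_norm_nonneg) auto
  finally show "gauss_norm M \<gamma> N (\<lambda>n. cblinfun_apply (T n) (x n)) \<le> (\<Sum>k. C k) * gauss_norm M \<gamma> N x" .
qed

end

section \<open>Exponentially damped semigroups\<close>

theorem corollary5p5:
  fixes M :: "'w measure" and \<gamma> :: "nat \<Rightarrow> 'w \<Rightarrow> complex"
    and T :: "real \<Rightarrow> 'a::cbanach \<Rightarrow>\<^sub>C\<^sub>L 'a"
  assumes "complex_gaussian_sequence M \<gamma>"
    and "K_convex M \<gamma> TYPE('a)"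
    and "C0_semigroup T"
    and "bounded (T ` {0..})"
    and "\<exists>\<delta>>0. gamma_bounded M \<gamma> {exp (- \<delta> * t) *\<^sub>R T t | t. t \<ge> 0}"
  shows "\<forall>\<delta>>0. gamma_bounded M \<gamma> {exp (- \<delta> * t) *\<^sub>R T t | t. t \<ge> 0}"
proof (intro allI impI)
  fix \<delta> :: real assume \<delta>: "0 < \<delta>"
  interpret complex_gaussian_sequence M \<gamma> by fact
  obtain \<delta>\<^sub>0 C where \<delta>\<^sub>0: "0 < \<delta>\<^sub>0"
    and C: "gamma_bounded_with M \<gamma> C {exp (- \<delta>\<^sub>0 * t) *\<^sub>R T t | t. t \<ge> 0}" (is "gamma_bounded_with _ _ _ ?S")
    using assms(5) by (auto simp: gamma_bounded_iff_with)
  obtain B where B: "\<And>t. 0 \<le> t \<Longrightarrow> norm (T t) \<le> B"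
    using assms(4) by (auto simp: bounded_iff)
  define U where "U k = (exp (- \<delta> * real k) * exp \<delta>\<^sub>0) *\<^sub>R T (real k)" for k
  define R where "R k = {exp (- \<delta> * t) *\<^sub>R T t | t. real k \<le> t \<and> t < real k + 1}" for k :: nat
  have "gamma_bounded_with M \<gamma> (norm (U k) * C) (R k)" for k
  proof (rule gamma_bounded_with_factor[OF C])
    fix P assume "P \<in> R k"
    then obtain t where P: "P = exp (- \<delta> * t) *\<^sub>R T t" and t: "real k \<le> t" "t < real k + 1"
      by (auto simp: R_def)
    define s where "s = t - real k"
    have s: "0 \<le> s" "s < 1" "t = real k + s"
      using t by (auto simp: s_def)
    \<comment> \<open>The scalar that turns the weight \<open>exp \<delta>\<^sub>0 * exp (- \<delta>\<^sub>0 * s)\<close> into \<open>exp (- \<delta> * s)\<close>.\<close>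
    define a where "a = exp (- \<delta> * s - \<delta>\<^sub>0 * (1 - s))"
    have "0 \<le> \<delta> * s" "0 \<le> \<delta>\<^sub>0 * (1 - s)"
      using s \<delta> \<delta>\<^sub>0 by simp_all
    then have "\<bar>a\<bar> \<le> 1"
      by (simp add: a_def)
    moreover have "cblinfun_apply P z
        = cblinfun_apply (U k) (cblinfun_apply (exp (- \<delta>\<^sub>0 * s) *\<^sub>R T s) (a *\<^sub>R z))" for z
    proof -
      have "cblinfun_apply (T t) z = cblinfun_apply (T (real k)) (cblinfun_apply (T s) z)"
        using assms(3) s by (simp add: C0_semigroup_def)
      moreover have "exp (- \<delta> * real k) * exp \<delta>\<^sub>0 * (exp (- \<delta>\<^sub>0 * s) * a) = exp (- \<delta> * t)"
        by (simp add: a_def s exp_add[symmetric] algebra_simps)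
      ultimately show ?thesis
        by (simp add: P U_def scaleR_cblinfun.rep_eq mult.assoc
            linear_scale[OF bounded_linear.linear[OF cblinfun_linear]])
    qed
    ultimately show "\<exists>S\<in>?S. \<exists>a. \<bar>a\<bar> \<le> 1 \<and>
        (\<forall>z. cblinfun_apply P z = cblinfun_apply (U k) (cblinfun_apply S (a *\<^sub>R z)))"
      using s by blast
  qed
  moreover have "summable (\<lambda>k. norm (U k) * C)"
  proof (rule summable_mult2, rule summable_comparison_test')
    show "summable (\<lambda>k. exp \<delta>\<^sub>0 * B * exp (- \<delta>) ^ k)"
      using \<delta> by (intro summable_mult summable_geometric) simp
    show "norm (norm (U k)) \<le> exp \<delta>\<^sub>0 * B * exp (- \<delta>) ^ k" for k
      using B[of "real k"] by (simp add: U_def exp_of_nat_mult[symmetric] ac_simps)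
  qed
  ultimately have "gamma_bounded_with M \<gamma> (\<Sum>k. norm (U k) * C) (\<Union>k. R k)"
    by (rule gamma_bounded_with_UN)
  moreover have "(\<Union>k. R k) = {exp (- \<delta> * t) *\<^sub>R T t | t. t \<ge> 0}"
  proof
    show "(\<Union>k. R k) \<subseteq> {exp (- \<delta> * t) *\<^sub>R T t | t. t \<ge> 0}"
      by (force simp: R_def)
    have "exp (- \<delta> * t) *\<^sub>R T t \<in> R (nat \<lfloor>t\<rfloor>)" if "0 \<le> t" for t
      using that unfolding R_def by (auto intro!: exI[of _ t])
    then show "{exp (- \<delta> * t) *\<^sub>R T t | t. t \<ge> 0} \<subseteq> (\<Union>k. R k)"
      by blast
  qed
  ultimately show "gamma_bounded M \<gamma> {exp (- \<delta> * t) *\<^sub>R T t | t. t \<ge> 0}"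
    by (auto simp: gamma_bounded_iff_with)
qed

end
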